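(* Let $h^1,\dots,h^N\ge0$ and let $f:\{0,1\}^N\to\mathbb R$, $f(z)=\max_{\omega:\,z_\omega=1}h^\omega$, with $f(\mathbf 0)=0$. Let $\mathrm{EPM}_f=\{\pi\in\mathbb R^N:\pi^\top z\le f(z)\ \forall z\in\{0,1\}^N\}$. For any $\pi\in\mathrm{EPM}_f$, define $$\mathcal H_\pi:=\{(y,z)\in\mathbb R\times[0,1]^N:\ y\le\pi^\top z\}.$$ Then $\mathcal H_\pi$ is S-free with respect to $\mathrm{epi}(f)$, i.e. $\mathcal H_\pi$ is a closed convex set with $\mathrm{int}(\mathcal H_\pi)\cap\mathrm{epi}(f)=\emptyset$.
   Context: $\mathrm{epi}(f)=\{(y,z)\in\mathbb R\times\{0,1\}^N:\ y\ge f(z)\}$ is the epigraph of $f$, and $\mathrm{int}$ denotes the interior. For a set $S\subseteq\mathbb R^n$, a closed convex set $B\subseteq\mathbb R^n$ is called S-free (with respect to $S$) if $\mathrm{int}(B)\cap S=\emptyset$. *)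

theory Defs
  imports "HOL-Analysis.Analysis"
begin

text \<open>The set $\{0,1\}^N$, where $N$ is the cardinality of the index type.\<close>

definition binary_vectors :: "(real ^ 'n) set" where
  "binary_vectors = {z. \<forall>\<omega>. z $ \<omega> \<in> {0, 1}}"

text \<open>
  Only the values of \<open>max_fun h\<close> on \<^const>\<open>binary_vectors\<close> matter; there, the maximum is taken over
  a nonempty finite set as soon as \<open>z \<noteq> 0\<close>.
\<close>

definition max_fun :: "real ^ 'n \<Rightarrow> real ^ 'n \<Rightarrow> real" where
  "max_fun h z = (if z = 0 then 0 else Max {h $ \<omega> | \<omega>. z $ \<omega> = 1})"

text \<open>
  The library's \<^const>\<open>epigraph\<close> has the value in the second coordinate; here it comes first.
\<close>

definition epi :: "(real ^ 'n \<Rightarrow> real) \<Rightarrow> (real \<times> (real ^ 'n)) set" where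
  "epi f = {(y, z). z \<in> binary_vectors \<and> y \<ge> f z}"

definition EPM :: "(real ^ 'n \<Rightarrow> real) \<Rightarrow> (real ^ 'n) set" where
  "EPM f = {\<pi>. \<forall>z \<in> binary_vectors. \<pi> \<bullet> z \<le> f z}"

definition S_free :: "'a::euclidean_space set \<Rightarrow> 'a set \<Rightarrow> bool" where
  "S_free S B \<longleftrightarrow> closed B \<and> convex B \<and> interior B \<inter> S = {}"

definition H_set :: "real ^ 'n \<Rightarrow> (real \<times> (real ^ 'n)) set" where
  "H_set \<pi> = {(y, z). (\<forall>\<omega>. z $ \<omega> \<in> {0..1}) \<and> y \<le> \<pi> \<bullet> z}"

end

theory Submission
  imports Defs
begin

text \<open>
  \<open>H_set \<pi>\<close> is the part of the closed half-space \<open>y \<le> \<pi> \<bullet> z\<close> that lies over the unit cube. An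
  intersection of closed convex sets is closed and convex, and the interior of \<open>H_set \<pi>\<close> is
  contained in the interior of the half-space, where \<open>y < \<pi> \<bullet> z\<close>. If \<open>\<pi> \<in> EPM f\<close>, every
  point of \<open>epi f\<close> satisfies \<open>\<pi> \<bullet> z \<le> f z \<le> y\<close>, so it is not in that interior.
\<close>

text \<open>
  With normal vector \<open>(1, - \<pi>)\<close> the inequality \<open>y \<le> \<pi> \<bullet> z\<close> takes the form for which the library
  provides closedness, convexity and the interior.
\<close>

lemma H_set_eq_halfspace_Int_cylinder:
  "H_set \<pi> = {x. (1, - \<pi>) \<bullet> x \<le> 0} \<inter> UNIV \<times> cbox 0 1"
  by (auto simp: H_set_def mem_box_cart)

lemma closed_H_set: "closed (H_set \<pi>)"
  unfolding H_set_eq_halfspace_Int_cylinder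
  by (intro closed_Int closed_halfspace_le closed_Times closed_UNIV closed_cbox)

lemma convex_H_set: "convex (H_set \<pi>)"
  unfolding H_set_eq_halfspace_Int_cylinder
  by (intro convex_Int convex_halfspace_le convex_Times convex_UNIV convex_box)

lemma interior_H_set_subset: "interior (H_set \<pi>) \<subseteq> {(y, z). y < \<pi> \<bullet> z}"
proof -
  have "interior (H_set \<pi>) \<subseteq> interior {x. (1, - \<pi>) \<bullet> x \<le> 0}"
    unfolding H_set_eq_halfspace_Int_cylinder by (intro interior_mono) blast
  also have "\<dots> = {x. (1, - \<pi>) \<bullet> x < 0}"
    by (rule interior_halfspace_le) (simp add: zero_prod_def)
  also have "\<dots> = {(y, z). y < \<pi> \<bullet> z}"
    by auto
  finally show ?thesis .
qed

lemma S_free_epi_H_set: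
  assumes "\<pi> \<in> EPM f"
  shows "S_free (epi f) (H_set \<pi>)"
proof -
  have "epi f \<subseteq> {(y, z). \<pi> \<bullet> z \<le> y}"
    using assms by (fastforce simp: EPM_def epi_def)
  then have "interior (H_set \<pi>) \<inter> epi f = {}"
    using interior_H_set_subset[of \<pi>] by fastforce
  then show ?thesis
    by (simp add: S_free_def closed_H_set convex_H_set)
qed

theorem lemma1:
  fixes h \<pi> :: "real ^ 'n"
  assumes h_nonneg: "\<And>\<omega>. h $ \<omega> \<ge> 0"
    and pi_EPM: "\<pi> \<in> EPM (max_fun h)"
  shows "S_free (epi (max_fun h)) (H_set \<pi>)"
  using pi_EPM by (rule S_free_epi_H_set)

end
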